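(* Let $n > 3$ be an integer and let $Q_n^2$ be the square of the hypercube $Q_n$. Then each of the eigenvalues of $Q_n^2$ is of the form $$\lambda_i = \tfrac{1}{2}n(n+1) - 2i(n+1) + 2i^2, \qquad 0 \le i \le \left\lfloor \tfrac{n+1}{2}\right\rfloor .$$ Moreover, the multiplicity of $\lambda_0$ is $1$, and writing $m(\lambda_i)$ for the multiplicity of $\lambda_i$: (a) if $n$ is even, then $m(\lambda_i) = \binom{n}{i} + \binom{n}{n+1-i}$ for $1 \le i \le \lfloor \frac{n+1}{2}\rfloor$; (b) if $n$ is odd, then $m(\lambda_i) = \binom{n}{i} + \binom{n}{n+1-i}$ for $1 \le i < \lfloor \frac{n+1}{2}\rfloor$, and $m(\lambda_j) = \binom{n}{j}$ for $j = \lfloor \frac{n+1}{2}\rfloor$.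
   Context: All graphs are finite, simple and undirected. The hypercube $Q_n$ is the graph with vertex set $\{0,1\}^n$ in which two $n$-tuples are adjacent if and only if they differ in precisely one coordinate. For a graph $\Gamma=(V,E)$, the square $\Gamma^2$ is the simple graph with vertex set $V$ in which two distinct vertices are adjacent if and only if their distance in $\Gamma$ is at most two. The eigenvalues of a graph, and their multiplicities, are those of its adjacency matrix (the $0/1$ matrix indexed by the vertices with entry $1$ exactly at adjacent pairs). *)

theory Defs
  imports
    Complex_Main
    "Graph_Theory.Pair_Digraph"
    "Graph_Theory.Shortest_Path"
    "Jordan_Normal_Form.Char_Poly"
begin

(* Simple undirected graphs are elements of pair_graph: finite, loop-free, and with a
   symmetric set of ordered pairs as arcs. The vertices {0,1}^n of the hypercube are the
   lists of n bits. *)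

definition hypercube :: "nat \<Rightarrow> bool list pair_pre_digraph" where
  "hypercube n =
    \<lparr> pverts = {x. length x = n},
      parcs = {(x, y). length x = n \<and> length y = n \<and> card {k. k < n \<and> x ! k \<noteq> y ! k} = 1} \<rparr>"

(* The shortest-path distance with unit arc weights; infinite between different components. *)
definition graph_dist :: "'a pair_pre_digraph \<Rightarrow> 'a \<Rightarrow> 'a \<Rightarrow> ereal" where
  "graph_dist G u v = wf_digraph.\<mu> (with_proj G) (\<lambda>_. 1) u v"

definition graph_square :: "'a pair_pre_digraph \<Rightarrow> 'a pair_pre_digraph" where
  "graph_square G =
    \<lparr> pverts = pverts G,
      parcs = {(u, v). u \<in> pverts G \<and> v \<in> pverts G \<and> u \<noteq> v \<and> graph_dist G u v \<le> 2} \<rparr>"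

lemma pair_graph_hypercube: "pair_graph (hypercube n)"
proof -
  have fin: "finite {x :: bool list. length x = n}"
    using finite_lists_length_eq[of "UNIV :: bool set" n] by simp
  have "parcs (hypercube n) \<subseteq> {x. length x = n} \<times> {x. length x = n}"
    by (auto simp: hypercube_def)
  then have fin_arcs: "finite (parcs (hypercube n))"
    using fin finite_subset by blast
  have "sym (parcs (hypercube n))"
  proof (rule symI)
    fix x y assume "(x, y) \<in> parcs (hypercube n)"
    moreover have "{k. k < n \<and> x ! k \<noteq> y ! k} = {k. k < n \<and> y ! k \<noteq> x ! k}"
      by blast
    ultimately show "(y, x) \<in> parcs (hypercube n)"
      by (simp add: hypercube_def)
  qed
  then have "symmetric (with_proj (hypercube n))"
    by (simp add: symmetric_def)
  moreover have "x \<noteq> y" if "(x, y) \<in> parcs (hypercube n)" for x y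
    using that by (auto simp: hypercube_def)
  moreover have "x \<in> pverts (hypercube n) \<and> y \<in> pverts (hypercube n)"
    if "(x, y) \<in> parcs (hypercube n)" for x y
    using that by (simp add: hypercube_def)
  moreover have "finite (pverts (hypercube n))"
    using fin by (simp add: hypercube_def)
  ultimately show ?thesis
    using fin_arcs by unfold_locales fastforce+
qed

lemma graph_dist_sym:
  assumes "pair_graph G"
  shows "graph_dist G u v = graph_dist G v u"
proof -
  interpret pair_graph G by fact
  have rev: "\<exists>q. awalk y q x \<and> length q = length p" if "awalk x p y" for x p y
    using that
  proof (induction p arbitrary: x)
    case Nil
    then show ?case by (auto simp: awalk_Nil_iff)
  next
    case (Cons e p)
    then have e: "e \<in> parcs G" "fst e = x" and p: "awalk (snd e) p y"
      by (auto simp: awalk_Cons_iff)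
    obtain q where q: "awalk y q (snd e)" "length q = length p"
      using Cons.IH[OF p] by blast
    have "(snd e, x) \<in> parcs G"
      using e arcs_symmetric[of x "snd e"] by auto
    then have "awalk (snd e) [(snd e, x)] x"
      by (simp add: awalk_Cons_iff awalk_Nil_iff wellformed')
    with q have "awalk y (q @ [(snd e, x)]) x"
      by (blast intro: awalk_appendI)
    moreover have "length (q @ [(snd e, x)]) = length (e # p)"
      using q(2) by simp
    ultimately show ?case
      by blast
  qed
  have cost: "awalk_cost (\<lambda>_. 1) p = real (length p)" for p :: "('a \<times> 'a) list"
    by (induction p) auto
  have le: "graph_dist G y x \<le> graph_dist G x y" for x y
    unfolding graph_dist_def \<mu>_def cost 
  proof (rule INF_mono)
    fix p assume "p \<in> {p. awalk x p y}"
    with rev[of x p y] show "\<exists>q\<in>{p. awalk y p x}. ereal (length q) \<le> ereal (length p)"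
      by (metis mem_Collect_eq order_refl)
  qed
  show ?thesis
    by (intro antisym le)
qed

lemma pair_graph_square:
  assumes "pair_graph G"
  shows "pair_graph (graph_square G)"
proof -
  interpret pair_graph G by fact
  have "parcs (graph_square G) \<subseteq> pverts G \<times> pverts G"
    by (auto simp: graph_square_def)
  then have "finite (parcs (graph_square G))"
    using pair_finite_verts finite_subset by blast
  moreover have "sym (parcs (graph_square G))"
    using graph_dist_sym[OF assms] by (auto simp: graph_square_def intro!: symI)
  ultimately show ?thesis
    using pair_finite_verts by unfold_locales (auto simp: graph_square_def symmetric_def)
qed

(* Adjacency matrix with respect to an enumeration vs of the vertices. Its entries are taken
   in the complex numbers so that all roots of its characteristic polynomial are seen. *)
definition adj_matrix :: "'a list \<Rightarrow> 'a pair_pre_digraph \<Rightarrow> complex mat" where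
  "adj_matrix vs G =
    mat (length vs) (length vs) (\<lambda>(i, j). if (vs ! i, vs ! j) \<in> parcs G then 1 else 0)"

definition multiplicity_eigenvalue :: "complex mat \<Rightarrow> complex \<Rightarrow> nat" where
  "multiplicity_eigenvalue A x = Polynomial.order x (char_poly A)"

end

theory Submission
  imports Defs
begin

text \<open>The square of \<open>Q\<^sub>n\<close> joins two words exactly when their Hamming distance is 1 or 2, so it is a
  Cayley graph of \<open>\<int>\<^sub>2\<^sup>n\<close> and the characters \<open>y \<mapsto> (-1)\<^bsup>\<langle>u,y\<rangle>\<^esup>\<close> diagonalise its adjacency matrix.
  If \<open>u\<close> has weight \<open>w\<close>, its eigenvalue is \<open>e\<^sub>1 + e\<^sub>2\<close>, the elementary symmetric polynomials of the
  \<open>n\<close> signs \<open>(-1)\<^bsup>u\<^sub>i\<^esup>\<close>; these are \<open>n - 2 w\<close> and \<open>((n - 2 w)\<^sup>2 - n) / 2\<close>, whose sum is \<open>\<lambda>\<^sub>w\<close>. As a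
  function of \<open>w\<close> this is a parabola symmetric about \<open>(n + 1) / 2\<close>, so \<open>\<lambda>\<^sub>i\<close> is attained precisely at
  the weights \<open>i\<close> and \<open>n + 1 - i\<close>, the latter occurring only for \<open>i \<ge> 1\<close>.\<close>

section \<open>Hamming distance on words\<close>

definition hamming :: "'a list \<Rightarrow> 'a list \<Rightarrow> nat" where
  "hamming x y = length (filter (\<lambda>(a, b). a \<noteq> b) (zip x y))"

lemma hamming_simps [simp]:
  "hamming [] y = 0"
  "hamming x [] = 0"
  "hamming (a # x) (b # y) = (if a = b then hamming x y else Suc (hamming x y))"
  by (simp_all add: hamming_def)

lemma hamming_eq_card:
  assumes "length x = n" "length y = n"
  shows "hamming x y = card {k. k < n \<and> x ! k \<noteq> y ! k}"
  using assms unfolding hamming_def length_filter_conv_card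
  by (intro arg_cong[where f = card]) auto

lemma hamming_eq_0_iff: "length x = length y \<Longrightarrow> hamming x y = 0 \<longleftrightarrow> x = y"
  by (induction x y rule: list_induct2) auto

lemma hamming_triangle:
  "length x = length w \<Longrightarrow> length w = length y \<Longrightarrow> hamming x y \<le> hamming x w + hamming w y"
  by (induction x w y rule: list_induct3) auto

text \<open>The first letter at which \<open>x\<close> differs from \<open>y\<close> is changed to
  that of \<open>y\<close>, which lowers the distance by one.\<close>

lemma hamming_SucE:
  assumes "length x = length y" "hamming x y = Suc k"
  obtains w where "length w = length x" "hamming x w = 1" "hamming w y = k"
proof -
  have "\<exists>w. length w = length x \<and> hamming x w = 1 \<and> hamming w y = k"
    using assms
  proof (induction x y rule: list_induct2)
    case Nil
    then show ?case by simp
  next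
    case (Cons a x b y)
    show ?case
    proof (cases "a = b")
      case True
      with Cons obtain w where "length w = length x" "hamming x w = 1" "hamming w y = k"
        by auto
      then show ?thesis
        using True by (intro exI[of _ "a # w"]) simp
    next
      case False
      have "hamming x x = 0"
        by (simp add: hamming_eq_0_iff)
      then show ?thesis
        using Cons.prems False by (intro exI[of _ "b # x"]) simp
    qed
  qed
  then show ?thesis
    using that by blast
qed

section \<open>Adjacency in the square of a graph and of the hypercube\<close>

text \<open>The distance is an infimum in \<open>ereal\<close>, infinite if no walk exists. Lengths
  are integers, so if every walk is longer than \<open>k\<close>, the infimum is at least
  \<open>k + 1\<close>.\<close>

lemma graph_dist_le_iff:
  assumes "pair_graph G"
  shows "graph_dist G u v \<le> ereal (real k) \<longleftrightarrow>
    (\<exists>p. pre_digraph.awalk (with_proj G) u p v \<and> length p \<le> k)"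
proof -
  interpret pair_graph G by fact
  have cost: "awalk_cost (\<lambda>_. 1) p = real (length p)" for p :: "('a \<times> 'a) list"
    by (induction p) auto
  show ?thesis
  proof
    assume le: "graph_dist G u v \<le> ereal (real k)"
    show "\<exists>p. awalk u p v \<and> length p \<le> k"
    proof (rule ccontr)
      assume "\<not> ?thesis"
      then have "ereal (real (Suc k)) \<le> ereal (real (length p))" if "awalk u p v" for p
        using that by (auto simp: not_le)
      then have "ereal (real (Suc k)) \<le> graph_dist G u v"
        unfolding graph_dist_def \<mu>_def cost by (intro INF_greatest) auto
      from order_trans[OF this le] show False
        by simp
    qed
  next
    assume "\<exists>p. awalk u p v \<and> length p \<le> k"
    then show "graph_dist G u v \<le> ereal (real k)"
      unfolding graph_dist_def \<mu>_def cost by (auto intro: INF_lower2)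
  qed
qed

lemma parcs_graph_square_iff:
  assumes "pair_graph G"
  shows "(u, v) \<in> parcs (graph_square G) \<longleftrightarrow>
    u \<noteq> v \<and> ((u, v) \<in> parcs G \<or> (\<exists>w. (u, w) \<in> parcs G \<and> (w, v) \<in> parcs G))"
proof -
  interpret pair_graph G by fact
  have "graph_dist G u v \<le> 2 \<longleftrightarrow> (\<exists>p. awalk u p v \<and> length p \<le> 2)"
    using graph_dist_le_iff[OF assms, of u v 2] by simp
  moreover have "(\<exists>p. awalk u p v \<and> length p \<le> 2) \<longleftrightarrow>
      u = v \<and> u \<in> pverts G \<or> (u, v) \<in> parcs G \<or> (\<exists>w. (u, w) \<in> parcs G \<and> (w, v) \<in> parcs G)"
    (is "?L \<longleftrightarrow> ?R")
  proof
    assume ?L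
    then obtain p where p: "awalk u p v" "length p \<le> 2"
      by blast
    from p(2) consider "p = []" | e where "p = [e]" | e f where "p = [e, f]"
      by (cases p; cases "tl p") auto
    then show ?R
      using p(1) by cases (auto simp: awalk_simps)
  next
    assume ?R
    then consider "u = v" "u \<in> pverts G" | "(u, v) \<in> parcs G"
      | w where "(u, w) \<in> parcs G" "(w, v) \<in> parcs G"
      by blast
    then show ?L
    proof cases
      case 1
      then show ?thesis by (intro exI[of _ "[]"]) (simp add: awalk_simps)
    next
      case 2
      then show ?thesis
        by (intro exI[of _ "[(u, v)]"]) (auto simp: awalk_simps wellformed')
    next
      case 3
      then show ?thesis
        by (intro exI[of _ "[(u, w), (w, v)]"]) (auto simp: awalk_simps wellformed')
    qed
  qed
  ultimately show ?thesis
    by (auto simp: graph_square_def wellformed')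
qed

text \<open>By the triangle inequality two arcs reach Hamming distance at most 2; conversely
  \<open>hamming_SucE\<close> supplies the midpoint for words at distance 2.\<close>

lemma parcs_hypercube_square_iff:
  "(x, y) \<in> parcs (graph_square (hypercube n)) \<longleftrightarrow>
    length x = n \<and> length y = n \<and> (hamming x y = 1 \<or> hamming x y = 2)"
proof -
  have arc: "(x, y) \<in> parcs (hypercube n) \<longleftrightarrow> length x = n \<and> length y = n \<and> hamming x y = 1"
    for x y
    by (auto simp: hypercube_def hamming_eq_card)
  show ?thesis
  proof
    assume "(x, y) \<in> parcs (graph_square (hypercube n))"
    then have "x \<noteq> y" and path: "(x, y) \<in> parcs (hypercube n) \<or>
        (\<exists>w. (x, w) \<in> parcs (hypercube n) \<and> (w, y) \<in> parcs (hypercube n))"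
      unfolding parcs_graph_square_iff[OF pair_graph_hypercube] by auto
    then have len: "length x = n" "length y = n"
      by (auto simp: arc)
    have "hamming x y \<noteq> 0"
      using \<open>x \<noteq> y\<close> len by (simp add: hamming_eq_0_iff)
    moreover have "hamming x y \<le> 2"
      using path
    proof
      assume "\<exists>w. (x, w) \<in> parcs (hypercube n) \<and> (w, y) \<in> parcs (hypercube n)"
      then obtain w where "length w = n" "hamming x w = 1" "hamming w y = 1"
        by (auto simp: arc)
      with hamming_triangle[of x w y] len show ?thesis
        by simp
    qed (simp add: arc)
    ultimately show "length x = n \<and> length y = n \<and> (hamming x y = 1 \<or> hamming x y = 2)"
      using len by linarith
  next
    assume *: "length x = n \<and> length y = n \<and> (hamming x y = 1 \<or> hamming x y = 2)"
    then have "x \<noteq> y"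
      using hamming_eq_0_iff[of x y] by auto
    moreover have "(x, y) \<in> parcs (hypercube n) \<or>
        (\<exists>w. (x, w) \<in> parcs (hypercube n) \<and> (w, y) \<in> parcs (hypercube n))"
    proof (cases "hamming x y = 1")
      case False
      with * have "hamming x y = Suc 1" "length x = length y"
        by auto
      then obtain w where "length w = length x" "hamming x w = 1" "hamming w y = 1"
        using hamming_SucE by metis
      with * show ?thesis
        by (auto simp: arc)
    qed (use * in \<open>simp add: arc\<close>)
    ultimately show "(x, y) \<in> parcs (graph_square (hypercube n))"
      unfolding parcs_graph_square_iff[OF pair_graph_hypercube] by blast
  qed
qed

section \<open>Characters and their sums over Hamming spheres\<close>

text \<open>Symmetric in its two arguments, so that the character matrix can serve as its own
  inverse up to a scalar. The default value 1 is the empty product of signs.\<close>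

fun walsh :: "bool list \<Rightarrow> bool list \<Rightarrow> 'a :: comm_ring_1" where
  "walsh (a # u) (b # x) = (if a \<and> b then - walsh u x else walsh u x)"
| "walsh _ _ = 1"

lemma finite_bool_lists [simp]: "finite {y :: bool list. length y = n}"
  using finite_lists_length_eq[of "UNIV :: bool set" n] by simp

lemma sum_bool_lists_Suc:
  fixes f :: "bool list \<Rightarrow> 'a :: comm_monoid_add"
  shows "(\<Sum>y | length y = Suc n. f y) =
    (\<Sum>y | length y = n. f (True # y)) + (\<Sum>y | length y = n. f (False # y))"
proof -
  have "{y :: bool list. length y = Suc n} =
      (#) True ` {y. length y = n} \<union> (#) False ` {y. length y = n}"
    by (auto simp: length_Suc_conv image_iff)
  then have "(\<Sum>y | length y = Suc n. f y) =
      sum f ((#) True ` {y. length y = n}) + sum f ((#) False ` {y. length y = n})"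
    by (simp only:) (rule sum.union_disjoint; auto)
  then show ?thesis
    by (simp add: sum.reindex)
qed

text \<open>Split by the first letter of \<open>y\<close>: the two halves agree and double the sum
  if the heads of \<open>u\<close> and \<open>v\<close> are equal, and cancel otherwise.\<close>

lemma walsh_orthogonal:
  "length u = n \<Longrightarrow> length v = n \<Longrightarrow>
    (\<Sum>y | length y = n. walsh u y * walsh y v) = (if u = v then 2 ^ n else (0 :: 'a :: comm_ring_1))"
proof (induction n arbitrary: u v)
  case 0
  then show ?case by simp
next
  case (Suc n)
  then obtain a u' b v' where "u = a # u'" "v = b # v'" "length u' = n" "length v' = n"
    by (auto simp: length_Suc_conv)
  then show ?case
    using Suc.IH[of u' v'] by (cases a; cases b) (auto simp: sum_bool_lists_Suc sum_negf)
qed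

text \<open>The sums run over all words, with an indicator, so that \<open>sum_bool_lists_Suc\<close> applies.\<close>

definition walsh_sphere :: "nat \<Rightarrow> bool list \<Rightarrow> bool list \<Rightarrow> 'a :: comm_ring_1" where
  "walsh_sphere k x u = (\<Sum>y | length y = length x. if hamming x y = k then walsh y u else 0)"

lemma walsh_sphere_0: "walsh_sphere 0 x u = walsh x u"
proof -
  have "walsh_sphere 0 x u = (\<Sum>y | length y = length x. if x = y then walsh y u else (0 :: 'a))"
    unfolding walsh_sphere_def by (intro sum.cong) (auto simp: hamming_eq_0_iff)
  then show ?thesis
    by simp
qed

text \<open>A word at distance \<open>Suc k\<close> from \<open>a # x\<close> either keeps the head
  \<open>a\<close>, leaving \<open>Suc k\<close> changes for the tail, or flips it, leaving
  \<open>k\<close>. Each summand carries the sign of its head.\<close>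

lemma walsh_sphere_Suc_Cons:
  "walsh_sphere (Suc k) (a # x) (b # u) =
    (if a \<and> b then - walsh_sphere (Suc k) x u else walsh_sphere (Suc k) x u)
    + (if \<not> a \<and> b then - walsh_sphere k x u else (walsh_sphere k x u :: 'a :: comm_ring_1))"
proof -
  have neg: "(\<Sum>y\<in>Y. if Q y then - f y else 0) = - (\<Sum>y\<in>Y. if Q y then f y else 0)"
    for Y Q and f :: "bool list \<Rightarrow> 'a"
    by (simp add: sum_negf[symmetric] if_distrib cong: if_cong)
  show ?thesis
    by (cases a; cases b) (simp_all add: walsh_sphere_def sum_bool_lists_Suc neg cong: if_cong)
qed

text \<open>Flipping one letter of \<open>x\<close> multiplies the character by the sign of
  \<open>u\<close> there. So the sphere sum of radius \<open>k\<close> is \<open>walsh x u\<close>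
  times the elementary symmetric polynomial \<open>e_k\<close> of the signs; \<open>e_1\<close> is
  their sum.\<close>

lemma walsh_sphere_1:
  "length x = length u \<Longrightarrow>
    walsh_sphere 1 x u = (of_nat (length u) - 2 * of_nat (count_list u True)) * (walsh x u :: 'a :: comm_ring_1)"
proof (induction x u rule: list_induct2)
  case Nil
  then show ?case by (simp add: walsh_sphere_def)
next
  case (Cons a x b u)
  then show ?case
    by (cases a; cases b) (simp_all add: walsh_sphere_Suc_Cons walsh_sphere_0 algebra_simps)
qed

text \<open>This is \<open>2 e_2 = e_1^2 - p_2\<close>, where the squared signs sum to
  \<open>p_2 = length u\<close>. The doubled form avoids division and so makes sense in every
  commutative ring.\<close>

lemma walsh_sphere_2:
  "length x = length u \<Longrightarrow>
    2 * walsh_sphere 2 x u =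
      ((of_nat (length u) - 2 * of_nat (count_list u True))\<^sup>2 - of_nat (length u)) * (walsh x u :: 'a :: comm_ring_1)"
proof (induction x u rule: list_induct2)
  case Nil
  then show ?case by (simp add: walsh_sphere_def)
next
  case (Cons a x b u)
  \<comment> \<open>The recursion is doubled because the induction hypothesis only speaks of
    \<open>2 * walsh_sphere 2 x u\<close>.\<close>
  have "2 * walsh_sphere 2 (a # x) (b # u) =
      (if a \<and> b then - (2 * walsh_sphere 2 x u) else 2 * walsh_sphere 2 x u)
      + 2 * (if \<not> a \<and> b then - walsh_sphere 1 x u else (walsh_sphere 1 x u :: 'a))"
    using walsh_sphere_Suc_Cons[of 1 a x b u, where 'a = 'a] unfolding Suc_1
    by (simp add: distrib_left)
  then show ?case
    unfolding Cons.IH walsh_sphere_1[OF Cons.hyps]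
    by (cases a; cases b) (simp_all add: algebra_simps power2_eq_square)
qed

text \<open>Pascal's rule, by the first letter; the cardinality is taken as a sum of indicators to
  fit \<open>sum_bool_lists_Suc\<close>.\<close>

lemma card_bool_lists_count:
  "card {u. length u = n \<and> count_list u True = k} = n choose k"
proof -
  have "(\<Sum>u | length u = n. if count_list u True = k then 1 else 0) = n choose k"
  proof (induction n arbitrary: k)
    case 0
    then show ?case by (cases k) auto
  next
    case (Suc n)
    then show ?case by (cases k) (auto simp: sum_bool_lists_Suc)
  qed
  then show ?thesis
    by (simp add: sum.If_cases Collect_conj_eq)
qed

section \<open>Diagonalisation and the characteristic polynomial\<close>

text \<open>The inverse of \<open>P\<close> is \<open>P\<close> scaled by \<open>inverse c\<close>,
  so \<open>A * P = P * D\<close> is already a similarity.\<close>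

lemma similar_mat_of_involution:
  fixes A P D :: "'a :: field mat"
  assumes carr: "A \<in> carrier_mat N N" "P \<in> carrier_mat N N" "D \<in> carrier_mat N N"
    and PP: "P * P = c \<cdot>\<^sub>m 1\<^sub>m N" and c: "c \<noteq> 0" and AP: "A * P = P * D"
  shows "similar_mat A D"
proof (rule similar_matI)
  let ?Q = "inverse c \<cdot>\<^sub>m P"
  show "{A, D, P, ?Q} \<subseteq> carrier_mat N N"
    using carr by auto
  show PQ: "P * ?Q = 1\<^sub>m N" and "?Q * P = 1\<^sub>m N"
    using carr c PP by (auto simp: mult_smult_distrib mult_smult_assoc_mat intro!: eq_matI)
  have "P * D * ?Q = A * (P * ?Q)"
    using carr by (simp add: AP[symmetric] assoc_mult_mat[of _ N N _ N _ N])
  then show "A = P * D * ?Q"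
    using carr by (simp add: PQ)
qed

lemma sum_nth_distinct:
  assumes "distinct vs"
  shows "(\<Sum>k = 0..<length vs. f (vs ! k)) = sum f (set vs)"
  using sum.distinct_set_conv_list[OF assms, of f] by (simp add: sum_list_sum_nth)

text \<open>The columns of the character matrix \<open>P\<close> are eigenvectors, which gives
  \<open>A * P = P * D\<close> with \<open>D\<close> diagonal; orthogonality gives
  \<open>P * P = 2 ^ n\<close> times the identity.\<close>

lemma char_poly_hypercube_square:
  fixes vs :: "bool list list" and ev :: "bool list \<Rightarrow> complex"
  assumes vs: "distinct vs" "set vs = {x. length x = n}"
    and ev: "\<And>u. 2 * ev u = (of_nat n - 2 * of_nat (count_list u True)) * 2
      + (of_nat n - 2 * of_nat (count_list u True))\<^sup>2 - of_nat n"
  shows "char_poly (adj_matrix vs (graph_square (hypercube n))) = (\<Prod>u\<leftarrow>vs. [:- ev u, 1:])"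
proof -
  define A where "A = adj_matrix vs (graph_square (hypercube n))"
  define N where "N = length vs"
  define P where "P = mat N N (\<lambda>(i, j). walsh (vs ! i) (vs ! j) :: complex)"
  define D where "D = mat N N (\<lambda>(i, j). if i = j then ev (vs ! j) else 0)"
  have carr: "A \<in> carrier_mat N N" "P \<in> carrier_mat N N" "D \<in> carrier_mat N N"
    by (simp_all add: A_def P_def D_def N_def adj_matrix_def)
  have len: "length (vs ! i) = n" if "i < N" for i
    using that nth_mem[of i vs] unfolding vs(2) N_def by simp
  have eq_iff: "vs ! i = vs ! j \<longleftrightarrow> i = j" if "i < N" "j < N" for i j
    using that vs(1) by (simp add: nth_eq_iff_index_eq N_def)
  have sum_vs: "(\<Sum>k = 0..<N. f (vs ! k)) = (\<Sum>y | length y = n. f y)" for f :: "_ \<Rightarrow> complex"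
    unfolding N_def sum_nth_distinct[OF vs(1)] vs(2) ..
  have "P * P = 2 ^ n \<cdot>\<^sub>m 1\<^sub>m N"
  proof (rule eq_matI)
    fix i j assume "i < dim_row (2 ^ n \<cdot>\<^sub>m 1\<^sub>m N :: complex mat)" "j < dim_col (2 ^ n \<cdot>\<^sub>m 1\<^sub>m N :: complex mat)"
    then have ij: "i < N" "j < N"
      by auto
    then have "(P * P) $$ (i, j) = (\<Sum>k = 0..<N. walsh (vs ! i) (vs ! k) * walsh (vs ! k) (vs ! j))"
      by (simp add: P_def scalar_prod_def)
    also have "\<dots> = (if vs ! i = vs ! j then 2 ^ n else 0)"
      unfolding sum_vs[of "\<lambda>y. walsh (vs ! i) y * walsh y (vs ! j)"]
      by (intro walsh_orthogonal len ij)
    finally show "(P * P) $$ (i, j) = (2 ^ n \<cdot>\<^sub>m 1\<^sub>m N) $$ (i, j)"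
      using ij by (simp add: eq_iff)
  qed (simp_all add: P_def)
  moreover have "A * P = P * D"
  proof (rule eq_matI)
    fix i j assume "i < dim_row (P * D)" "j < dim_col (P * D)"
    then have ij: "i < N" "j < N"
      using carr by auto
    define x u where "x = vs ! i" and "u = vs ! j"
    have xu: "length x = n" "length u = n"
      using ij len by (auto simp: x_def u_def)
    have S: "walsh_sphere 1 x u = (of_nat n - 2 * of_nat (count_list u True)) * (walsh x u :: complex)"
      "2 * walsh_sphere 2 x u =
        ((of_nat n - 2 * of_nat (count_list u True))\<^sup>2 - of_nat n) * (walsh x u :: complex)"
      using walsh_sphere_1[of x u, where 'a = complex] walsh_sphere_2[of x u, where 'a = complex]
      by (simp_all add: xu)
    have "(A * P) $$ (i, j) =
        (\<Sum>k = 0..<N. (if (x, vs ! k) \<in> parcs (graph_square (hypercube n)) then 1 else 0) * walsh (vs ! k) u)"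
      using ij by (simp add: A_def P_def N_def adj_matrix_def scalar_prod_def x_def u_def)
    also have "\<dots> = (\<Sum>y | length y = n. (if (x, y) \<in> parcs (graph_square (hypercube n)) then 1 else 0) * walsh y u)"
      by (rule sum_vs[of "\<lambda>y. (if (x, y) \<in> parcs (graph_square (hypercube n)) then 1 else 0) * walsh y u"])
    \<comment> \<open>The spheres of radius 1 and 2 are disjoint, so their indicators add up to the
      adjacency indicator.\<close>
    also have "\<dots> = walsh_sphere 1 x u + walsh_sphere 2 x u"
      unfolding walsh_sphere_def sum.distrib[symmetric] xu
      by (intro sum.cong) (auto simp: parcs_hypercube_square_iff xu)
    \<comment> \<open>Both \<open>S\<close> and \<open>ev\<close> are given in doubled form; the
      factor 2 is cancelled afterwards.\<close>
    finally have "2 * (A * P) $$ (i, j) = 2 * walsh_sphere 1 x u + 2 * walsh_sphere 2 x u"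
      by simp
    also have "\<dots> = 2 * ev u * walsh x u"
      unfolding S ev by (simp add: algebra_simps)
    finally have "(A * P) $$ (i, j) = ev u * walsh x u"
      by simp
    moreover have "(P * D) $$ (i, j) = ev u * walsh x u"
      using ij by (simp add: P_def D_def scalar_prod_def x_def u_def if_distrib cong: if_cong)
    ultimately show "(A * P) $$ (i, j) = (P * D) $$ (i, j)"
      by simp
  qed (use carr in auto)
  ultimately have "similar_mat A D"
    using carr by (intro similar_mat_of_involution[where c = "2 ^ n"]) auto
  then have "char_poly A = char_poly D"
    by (rule char_poly_similar)
  also have "\<dots> = (\<Prod>a\<leftarrow>diag_mat D. [:- a, 1:])"
    using carr by (intro char_poly_upper_triangular) (auto simp: D_def)
  also have "diag_mat D = map ev vs"
    by (rule nth_equalityI) (auto simp: diag_mat_def D_def N_def)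
  finally show ?thesis
    by (simp add: A_def o_def)
qed

section \<open>Eigenvalues and their multiplicities\<close>

text \<open>Orders add over a product, and a linear factor contributes 1 exactly when it vanishes at
  \<open>x\<close>.\<close>

lemma order_prod_linear_factors:
  fixes f :: "'b \<Rightarrow> 'a :: field"
  assumes "distinct vs"
  shows "order x (\<Prod>u\<leftarrow>vs. [:- f u, 1:]) = card {u \<in> set vs. f u = x}"
proof -
  have "order x (\<Prod>u\<leftarrow>vs. [:- f u, 1:]) = (\<Sum>u\<leftarrow>vs. if f u = x then 1 else 0)"
    by (subst order_prod_list) (auto simp: o_def order_linear' cong: if_cong)
  also have "\<dots> = (\<Sum>u\<in>set vs. if f u = x then 1 else 0)"
    using assms by (simp add: sum.distinct_set_conv_list)
  also have "\<dots> = card {u \<in> set vs. f u = x}"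
    by (simp add: sum.If_cases Int_def)
  finally show ?thesis .
qed

theorem theorem4p1:
  fixes n :: nat
    and vs :: "bool list list"
    and A :: "complex mat"
    and lam :: "nat \<Rightarrow> real"
  assumes n: "n > 3"
    and vs: "distinct vs" "set vs = pverts (graph_square (hypercube n))"
    and A: "A = adj_matrix vs (graph_square (hypercube n))"
    and lam: "\<And>i. lam i = 1 / 2 * real n * (real n + 1) - 2 * real i * (real n + 1) + 2 * (real i)\<^sup>2"
  shows "(\<forall>x. eigenvalue A x \<longrightarrow>
            (\<exists>i. i \<le> (n + 1) div 2 \<and> x = complex_of_real (lam i)))
    \<and> multiplicity_eigenvalue A (complex_of_real (lam 0)) = 1
    \<and> (even n \<longrightarrow>
        (\<forall>i. 1 \<le> i \<and> i \<le> (n + 1) div 2 \<longrightarrow>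
          multiplicity_eigenvalue A (complex_of_real (lam i)) = (n choose i) + (n choose (n + 1 - i))))
    \<and> (odd n \<longrightarrow>
        (\<forall>i. 1 \<le> i \<and> i < (n + 1) div 2 \<longrightarrow>
          multiplicity_eigenvalue A (complex_of_real (lam i)) = (n choose i) + (n choose (n + 1 - i)))
        \<and> (\<forall>j. j = (n + 1) div 2 \<longrightarrow>
          multiplicity_eigenvalue A (complex_of_real (lam j)) = n choose j))"
proof -
  define ev where "ev u = complex_of_real (lam (count_list u True))" for u
  have set_vs: "set vs = {x. length x = n}"
    using vs(2) by (simp add: graph_square_def hypercube_def)
  \<comment> \<open>Twice \<open>e_1 + e_2\<close> at weight \<open>w\<close>, the form in which
    \<open>char_poly_hypercube_square\<close> takes the eigenvalues.\<close>
  have "complex_of_real (2 * lam w) =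
      complex_of_real ((real n - 2 * real w) * 2 + (real n - 2 * real w)\<^sup>2 - real n)" for w
    unfolding lam by (simp add: field_simps power2_eq_square)
  then have cp: "char_poly A = (\<Prod>u\<leftarrow>vs. [:- ev u, 1:])"
    unfolding A by (intro char_poly_hypercube_square vs(1) set_vs) (simp add: ev_def)
  have lam_eq_iff: "lam w = lam i \<longleftrightarrow> w = i \<or> w + i = n + 1" for w i
  proof -
    \<comment> \<open>The factors vanish at \<open>w = i\<close> and at its mirror image
      \<open>n + 1 - i\<close>.\<close>
    have "lam w - lam i = 2 * ((real w - real i) * (real w + real i - (real n + 1)))"
      unfolding lam by (simp add: field_simps power2_eq_square)
    then have "lam w = lam i \<longleftrightarrow> real w = real i \<or> real w + real i = real n + 1"
      by (metis eq_iff_diff_eq_0 mult_eq_0_iff zero_neq_numeral)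
    then show ?thesis
      by linarith
  qed
  have count: "card {u :: bool list. length u = n \<and> (count_list u True = k \<or> count_list u True = l)}
      = (n choose k) + (n choose l)" if "k \<noteq> l" for k l
  proof -
    have "{u :: bool list. length u = n \<and> (count_list u True = k \<or> count_list u True = l)} =
        {u. length u = n \<and> count_list u True = k} \<union> {u. length u = n \<and> count_list u True = l}"
      by auto
    then show ?thesis
      using that by (simp only:) (subst card_Un_disjoint; auto simp: card_bool_lists_count)
  qed
  have mult: "multiplicity_eigenvalue A (complex_of_real (lam i)) =
      card {u :: bool list. length u = n \<and> (count_list u True = i \<or> count_list u True + i = n + 1)}" for i
    unfolding multiplicity_eigenvalue_def cp order_prod_linear_factors[OF vs(1)]
    by (simp add: set_vs ev_def lam_eq_iff)
  \<comment> \<open>Excluding the fixed point \<open>2 * i = n + 1\<close> of the reflection keeps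
    the two weight classes disjoint; at the fixed point they coincide and count once.\<close>
  have mult_pair: "multiplicity_eigenvalue A (complex_of_real (lam i)) = (n choose i) + (n choose (n + 1 - i))"
    if "i \<le> n + 1" "2 * i \<noteq> n + 1" for i
  proof -
    have "i \<noteq> n + 1 - i" "\<And>w. w + i = n + 1 \<longleftrightarrow> w = n + 1 - i"
      using that by linarith+
    then show ?thesis
      unfolding mult by (simp only: count not_False_eq_True)
  qed
  have mult_mid: "multiplicity_eigenvalue A (complex_of_real (lam j)) = n choose j"
    if "2 * j = n + 1" for j
  proof -
    have "w = j \<or> w + j = n + 1 \<longleftrightarrow> w = j" for w
      using that by linarith
    then show ?thesis
      unfolding mult by (simp only: card_bool_lists_count)
  qed
  have "\<exists>i \<le> (n + 1) div 2. x = complex_of_real (lam i)" if "eigenvalue A x" for x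
  proof -
    have "A \<in> carrier_mat (length vs) (length vs)"
      by (simp add: A adj_matrix_def)
    with that have "poly (char_poly A) x = 0"
      by (simp add: eigenvalue_root_char_poly)
    then obtain u where u: "u \<in> set vs" "x = ev u"
      unfolding cp by (auto simp: poly_prod_list prod_list_zero_iff)
    let ?w = "count_list u True"
    have "?w \<le> n"
      using u(1) count_le_length[of u True] by (simp add: set_vs)
    \<comment> \<open>A weight above the middle is replaced by its mirror image, which has the same
      eigenvalue.\<close>
    then consider "?w \<le> (n + 1) div 2" | "n + 1 - ?w \<le> (n + 1) div 2" "?w + (n + 1 - ?w) = n + 1"
      by linarith
    then show ?thesis
    proof cases
      case 1
      then show ?thesis
        using u(2) unfolding ev_def by blast
    next
      case 2
      then have "lam ?w = lam (n + 1 - ?w)"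
        unfolding lam_eq_iff by blast
      then show ?thesis
        using u(2) 2(1) unfolding ev_def by metis
    qed
  qed
  \<comment> \<open>The mirror image of weight 0 is \<open>n + 1\<close>, which no word attains: its
    binomial coefficient is 0.\<close>
  moreover have "multiplicity_eigenvalue A (complex_of_real (lam 0)) = 1"
    using mult_pair[of 0] by simp
  \<comment> \<open>Parity enters only here: for even \<open>n\<close> the reflection fixes no
    index, for odd \<open>n\<close> it fixes \<open>(n + 1) div 2\<close>.\<close>
  moreover have "multiplicity_eigenvalue A (complex_of_real (lam i)) = (n choose i) + (n choose (n + 1 - i))"
    if "even n" "i \<le> (n + 1) div 2" for i
  proof (rule mult_pair)
    show "i \<le> n + 1" using that(2) by linarith
    show "2 * i \<noteq> n + 1" using that(1) by presburger
  qed
  moreover have "multiplicity_eigenvalue A (complex_of_real (lam i)) = (n choose i) + (n choose (n + 1 - i))"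
    if "i < (n + 1) div 2" for i
    by (rule mult_pair) (use that in linarith)+
  moreover have "multiplicity_eigenvalue A (complex_of_real (lam ((n + 1) div 2))) = n choose ((n + 1) div 2)"
    if "odd n"
    by (rule mult_mid) (use that in simp)
  ultimately show ?thesis
    by blast
qed

end
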